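(* Let $x,y,z,q$ be complex numbers with $|q|<1$, $y\neq q^{-n}$ and $y\neq xzq^{n}$ for every integer $n\ge 0$. Define $$\phi(x,y,z,q):=\sum_{n=0}^{\infty}\frac{x^{n}q^{n(n+1)/2}(-z;q)_{n}}{(y;q)_{n+1}(q;q)_{n}},$$ and for each positive integer $m$ define $$e_m(x,y,z,q):=\sum_{n\ge 0}x^{n}q^{n(n+1)/2}\sum_{j\ge 0}\begin{bmatrix} n+j\\ j\end{bmatrix}y^{j}\sum_{l\ge 0}\begin{bmatrix} m-1-j-l\\ n\end{bmatrix}q^{l(l-1)/2}z^{l}\begin{bmatrix} n\\ l\end{bmatrix}.$$ Then for every integer $m\ge 2$, $$\phi(xq^m,y,z,q)=\frac{e_m(x,y,z,q)\,\phi(xq,y,z,q)-e_{m-1}(xq,y,z,q)\,\phi(x,y,z,q)}{\prod_{j=1}^{m-1}(y-xzq^{j})}.$$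
   Context: $(a;q)_n=\prod_{k=0}^{n-1}(1-aq^k)$ for $n\ge 0$, $(a;q)_\infty=\prod_{k\ge0}(1-aq^k)$. The Gaussian polynomial $\begin{bmatrix} N\\ M\end{bmatrix}=\begin{bmatrix} N\\ M\end{bmatrix}_q$ equals $\frac{(q;q)_N}{(q;q)_M(q;q)_{N-M}}$ if $0\le M\le N$ and $0$ otherwise (in particular it is $0$ when $N<0$). All summation indices range over nonnegative integers. *)

theory Defs
  imports "HOL-Analysis.Analysis"
begin

definition qpoch :: "complex \<Rightarrow> complex \<Rightarrow> nat \<Rightarrow> complex" where
  "qpoch a q n = (\<Prod>k<n. 1 - a * q ^ k)"

text \<open>The arguments are integers because the upper one can be negative, in which case the value is 0.\<close>

definition gauss_poly :: "complex \<Rightarrow> int \<Rightarrow> int \<Rightarrow> complex" where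
  "gauss_poly q N M =
     (if 0 \<le> M \<and> M \<le> N
      then qpoch q q (nat N) / (qpoch q q (nat M) * qpoch q q (nat (N - M)))
      else 0)"

definition phi :: "complex \<Rightarrow> complex \<Rightarrow> complex \<Rightarrow> complex \<Rightarrow> complex" where
  "phi x y z q =
     (\<Sum>n. x ^ n * q ^ (n * (n + 1) div 2) * qpoch (- z) q n / (qpoch y q (n + 1) * qpoch q q n))"

text \<open>For fixed \<open>m\<close> only finitely many triples \<open>(n, j, l)\<close> contribute to the following sums.\<close>

definition e_sum :: "nat \<Rightarrow> complex \<Rightarrow> complex \<Rightarrow> complex \<Rightarrow> complex \<Rightarrow> complex" where
  "e_sum m x y z q =
     (\<Sum>n. x ^ n * q ^ (n * (n + 1) div 2) *
       (\<Sum>j. gauss_poly q (int (n + j)) (int j) * y ^ j *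
         (\<Sum>l. gauss_poly q (int m - 1 - int j - int l) (int n) *
            q ^ (l * (l - 1) div 2) * z ^ l * gauss_poly q (int n) (int l))))"

end

theory Submission
  imports Defs "HOL-Computational_Algebra.Formal_Power_Series"
begin

text \<open>
  Comparing consecutive terms of the series shows that \<open>\<phi>\<close> satisfies the \<open>q\<close>-difference equation
  \<open>(y - xzq) \<phi>(xq\<^sup>2) = (1 + y + xq) \<phi>(xq) - \<phi>(x)\<close>, so it suffices that \<open>e\<^sub>m(x)\<close> obeys the matching
  three-term recurrence \<open>e\<^sub>m\<^sub>+\<^sub>2 = (1 + y + xq\<^bsup>m+1\<^esup>) e\<^sub>m\<^sub>+\<^sub>1 - (y - xzq\<^sup>m) e\<^sub>m\<close> with \<open>e\<^sub>0 = 0\<close> and \<open>e\<^sub>1 = 1\<close>.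
  The generating function \<open>E(t)\<close> of the sequence \<open>e\<^sub>m\<^sub>+\<^sub>1\<close> is the sum over \<open>n\<close> of
  \<open>F\<^sub>n(t) = x\<^sup>n q\<^bsup>n(n+1)/2\<^esup> t\<^sup>n (-zt; q)\<^sub>n / ((t; q)\<^sub>n\<^sub>+\<^sub>1 (yt; q)\<^sub>n\<^sub>+\<^sub>1)\<close>. Since
  \<open>(1 - t) (1 - yt) F\<^sub>n\<^sub>+\<^sub>1(t) = xqt (1 + zt) F\<^sub>n(qt)\<close>, it satisfies
  \<open>(1 - t) (1 - yt) E(t) = 1 + xqt (1 + zt) E(qt)\<close>, and comparing coefficients gives the recurrence.
\<close>

unbundle no vec_syntax
unbundle fps_syntax

section \<open>Recurrences, series and formal power series\<close>

lemma prod_mult_three_term_recurrence: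
  fixes u A B b d :: "nat \<Rightarrow> 'a::comm_ring_1"
  assumes u: "\<And>k. d (Suc k) * u (Suc (Suc k)) = b (Suc k) * u (Suc k) - u k"
    and A: "\<And>k. A (Suc (Suc k)) = b (Suc k) * A (Suc k) - d k * A k"
    and B: "\<And>k. B (Suc (Suc k)) = b (Suc (Suc k)) * B (Suc k) - d (Suc k) * B k"
    and init: "A 0 = 0" "A (Suc 0) = 1" "B 0 = 0" "B (Suc 0) = 1"
  shows "(\<Prod>j=1..m. d j) * u (Suc m) = A (Suc m) * u (Suc 0) - B m * u 0"
proof (induction m rule: induct_nat_012)
  case 0
  show ?case by (simp add: init)
next
  case 1
  show ?case by (simp add: u A init)
next
  case (ge2 m)
  define P where "P = (\<Prod>j=1..m. d j)"
  have "(\<Prod>j=1..Suc (Suc m). d j) * u (Suc (Suc (Suc m))) =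
      P * d (Suc m) * (d (Suc (Suc m)) * u (Suc (Suc (Suc m))))"
    by (simp add: P_def mult.assoc)
  also have "\<dots> = b (Suc (Suc m)) * (P * d (Suc m) * u (Suc (Suc m))) - d (Suc m) * (P * u (Suc m))"
    by (simp add: u algebra_simps)
  also have "\<dots> = b (Suc (Suc m)) * (A (Suc (Suc m)) * u (Suc 0) - B (Suc m) * u 0) -
      d (Suc m) * (A (Suc m) * u (Suc 0) - B m * u 0)"
    using ge2 by (simp add: P_def)
  also have "\<dots> = A (Suc (Suc (Suc m))) * u (Suc 0) - B (Suc (Suc m)) * u 0"
    by (simp add: A[of "Suc m"] B[of m] algebra_simps)
  finally show ?case .
qed

lemma summable_ratio_tendsto:
  fixes f r :: "nat \<Rightarrow> 'a::{banach, real_normed_algebra}"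
  assumes ratio: "\<And>n. f (Suc n) = r n * f n" and "r \<longlonglongrightarrow> L" and "norm L < 1"
  shows "summable f"
proof -
  obtain c where c: "norm L < c" "c < 1"
    using dense[OF assms(3)] by blast
  have "\<forall>\<^sub>F n in sequentially. norm (r n) < c"
    using tendsto_norm[OF assms(2)] c(1) by (rule order_tendstoD)
  then obtain N where N: "\<And>n. n \<ge> N \<Longrightarrow> norm (r n) < c"
    by (auto simp: eventually_sequentially)
  show ?thesis
  proof (rule summable_ratio_test[OF c(2), of N])
    fix n assume "N \<le> n"
    have "norm (f (Suc n)) \<le> norm (r n) * norm (f n)"
      unfolding ratio by (rule norm_mult_ineq)
    also have "\<dots> \<le> c * norm (f n)"
      using N[OF \<open>N \<le> n\<close>] by (intro mult_right_mono) auto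
    finally show "norm (f (Suc n)) \<le> c * norm (f n)" .
  qed
qed

lemma fps_mult_nth_suminf:
  fixes f g :: "'a::{semiring_0, t2_space} fps"
  assumes "\<And>k. k \<le> n \<Longrightarrow> h k = g $ (n - k)" and "\<And>k. n < k \<Longrightarrow> h k = 0"
  shows "(f * g) $ n = (\<Sum>k. f $ k * h k)"
proof -
  have "(\<Sum>k. f $ k * h k) = (\<Sum>k\<le>n. f $ k * h k)"
    using assms(2) by (intro suminf_finite) auto
  then show ?thesis
    using assms(1) by (simp add: fps_mult_nth atLeast0AtMost)
qed

lemma fps_mult_nth_sums:
  fixes g :: "'a::real_normed_algebra fps"
  assumes "\<And>k. (\<lambda>n. f n $ k) sums (F $ k)"
  shows "(\<lambda>n. (g * f n) $ k) sums ((g * F) $ k)"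
  unfolding fps_mult_nth by (intro sums_sum sums_mult assms)

definition fps_dilate :: "'a::comm_ring_1 \<Rightarrow> 'a fps \<Rightarrow> 'a fps" where
  "fps_dilate c f = f oo (fps_const c * fps_X)"

lemma fps_dilate_nth [simp]: "fps_dilate c f $ n = c ^ n * f $ n"
  by (simp add: fps_dilate_def)

lemma fps_dilate_mult: "fps_dilate c (f * g) = fps_dilate c f * fps_dilate c g"
  for c :: "'a::idom"
  by (simp add: fps_dilate_def fps_compose_mult_distrib)

lemma fps_dilate_const [simp]: "fps_dilate c (fps_const a) = fps_const a"
  by (simp add: fps_dilate_def)

lemma fps_dilate_1 [simp]: "fps_dilate c 1 = 1"
  by (simp add: fps_dilate_def)

lemma fps_dilate_one_minus_X: "fps_dilate c (1 - fps_X) = 1 - fps_const c * fps_X"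
  by (simp add: fps_dilate_def fps_compose_sub_distrib)

lemma fps_dilate_X_power: "fps_dilate c (fps_X ^ n) = fps_const (c ^ n) * fps_X ^ n"
  by (rule fps_ext) simp

lemma fps_dilate_commute: "fps_dilate c (fps_dilate d f) = fps_dilate d (fps_dilate c f)"
  by (rule fps_ext) (simp add: mult.left_commute)

section \<open>Gaussian polynomials\<close>

lemma qpoch_0 [simp]: "qpoch a q 0 = 1"
  by (simp add: qpoch_def)

lemma qpoch_Suc: "qpoch a q (Suc n) = qpoch a q n * (1 - a * q ^ n)"
  by (simp add: qpoch_def)

lemma triangular_Suc: "Suc n * (Suc n + 1) div 2 = n * (n + 1) div 2 + Suc n"
  by simp

lemma triangular_pred_Suc: "Suc n * (Suc n - 1) div 2 = n * (n - 1) div 2 + n"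
  by (cases n) simp_all

lemma gauss_poly_eq_0: "n < k \<Longrightarrow> gauss_poly q n k = 0"
  by (simp add: gauss_poly_def)

lemma gauss_poly_symmetric: "gauss_poly q n k = gauss_poly q n (n - k)"
  by (auto simp: gauss_poly_def mult.commute)

lemma gauss_poly_add:
  "gauss_poly q (int (k + d)) (int k) = qpoch q q (k + d) / (qpoch q q k * qpoch q q d)"
  by (simp add: gauss_poly_def nat_add_distrib)

text \<open>
  By the \<open>q\<close>-binomial theorem these are the expansions of \<open>1 / (t; q)\<^sub>n\<^sub>+\<^sub>1\<close> and \<open>(-zt; q)\<^sub>n\<close>; only the
  recurrences in \<open>n\<close> that these products satisfy are needed.
\<close>

definition gauss_column_fps :: "complex \<Rightarrow> nat \<Rightarrow> complex fps" where
  "gauss_column_fps q n = Abs_fps (\<lambda>j. gauss_poly q (int (n + j)) (int j))"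

definition gauss_row_fps :: "complex \<Rightarrow> complex \<Rightarrow> nat \<Rightarrow> complex fps" where
  "gauss_row_fps q z n =
     Abs_fps (\<lambda>l. q ^ (l * (l - 1) div 2) * z ^ l * gauss_poly q (int n) (int l))"

lemma X_power_mult_gauss_column_fps_nth:
  "(fps_X ^ n * gauss_column_fps q n) $ k = gauss_poly q (int k) (int n)"
proof (cases "k < n")
  case True
  then show ?thesis by (simp add: fps_X_power_mult_nth gauss_poly_eq_0)
next
  case False
  then show ?thesis
    using gauss_poly_symmetric[of q "int k" "int n"]
    by (simp add: fps_X_power_mult_nth gauss_column_fps_def)
qed

locale non_root_of_unity =
  fixes q :: complex
  assumes power_neq_1: "0 < k \<Longrightarrow> q ^ k \<noteq> 1"
begin

lemma qpoch_q_q_nonzero: "qpoch q q n \<noteq> 0"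
  using power_neq_1[of "Suc k" for k] by (simp add: qpoch_def)

lemma gauss_poly_0_right: "gauss_poly q (int n) 0 = 1"
  using gauss_poly_add[of q 0 n] qpoch_q_q_nonzero by simp

lemma gauss_poly_self: "gauss_poly q (int n) (int n) = 1"
  using gauss_poly_add[of q n 0] qpoch_q_q_nonzero by simp

lemma gauss_poly_Suc_Suc:
  "gauss_poly q (int (Suc n)) (int (Suc k)) =
    q ^ Suc k * gauss_poly q (int n) (int (Suc k)) + gauss_poly q (int n) (int k)"
proof -
  consider "n < k" | "n = k" | d where "n = Suc (k + d)"
    using less_iff_Suc_add by (metis linorder_neqE_nat)
  then show ?thesis
  proof cases
    case 1
    then show ?thesis by (simp add: gauss_poly_eq_0)
  next
    case 2
    then show ?thesis by (simp only: gauss_poly_self) (simp add: gauss_poly_eq_0)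
  next
    case 3
    let ?Q = "qpoch q q"
    have Q_Suc: "?Q (Suc m) = ?Q m * (1 - q ^ Suc m)" for m
      by (simp add: qpoch_Suc)
    note nonzero = qpoch_q_q_nonzero[of "Suc k"] qpoch_q_q_nonzero[of "Suc d"]
    have "gauss_poly q (int (Suc n)) (int (Suc k)) = ?Q n * (1 - q ^ Suc n) / (?Q (Suc k) * ?Q (Suc d))"
      using gauss_poly_add[of q "Suc k" "Suc d"] 3 by (simp add: Q_Suc)
    also have "1 - q ^ Suc n = q ^ Suc k * (1 - q ^ Suc d) + (1 - q ^ Suc k)"
      by (simp add: 3 power_add algebra_simps)
    also have "?Q n * (q ^ Suc k * (1 - q ^ Suc d) + (1 - q ^ Suc k)) / (?Q (Suc k) * ?Q (Suc d)) =
        q ^ Suc k * (?Q n / (?Q (Suc k) * ?Q d)) + ?Q n / (?Q k * ?Q (Suc d))"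
      using nonzero by (simp add: Q_Suc divide_simps del: power_Suc) (simp add: algebra_simps)
    also have "?Q n / (?Q (Suc k) * ?Q d) = gauss_poly q (int n) (int (Suc k))"
      using gauss_poly_add[of q "Suc k" d] 3 by simp
    also have "?Q n / (?Q k * ?Q (Suc d)) = gauss_poly q (int n) (int k)"
      using gauss_poly_add[of q k "Suc d"] 3 by simp
    finally show ?thesis .
  qed
qed

lemma gauss_column_fps_0: "(1 - fps_X) * gauss_column_fps q 0 = 1"
proof (rule fps_ext)
  fix j
  show "((1 - fps_X) * gauss_column_fps q 0) $ j = 1 $ j"
    by (cases j) (simp_all add: gauss_column_fps_def gauss_poly_self left_diff_distrib del: of_nat_Suc)
qed

lemma gauss_column_fps_Suc:
  "(1 - fps_X) * gauss_column_fps q (Suc n) = fps_dilate q (gauss_column_fps q n)"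
proof (rule fps_ext)
  fix j
  show "((1 - fps_X) * gauss_column_fps q (Suc n)) $ j = fps_dilate q (gauss_column_fps q n) $ j"
  proof (cases j)
    case 0
    then show ?thesis
      using gauss_poly_0_right[of n] gauss_poly_0_right[of "Suc n"]
      by (simp add: gauss_column_fps_def left_diff_distrib)
  next
    case (Suc i)
    then show ?thesis
      using gauss_poly_Suc_Suc[of "n + Suc i" i]
      by (simp add: gauss_column_fps_def left_diff_distrib add_ac)
  qed
qed

lemma gauss_row_fps_0: "gauss_row_fps q z 0 = 1"
  by (rule fps_ext) (simp add: gauss_row_fps_def gauss_poly_def)

lemma gauss_row_fps_Suc:
  "gauss_row_fps q z (Suc n) = (1 + fps_const z * fps_X) * fps_dilate q (gauss_row_fps q z n)"
proof (rule fps_ext)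
  fix l
  show "gauss_row_fps q z (Suc n) $ l =
    ((1 + fps_const z * fps_X) * fps_dilate q (gauss_row_fps q z n)) $ l"
  proof (cases l)
    case 0
    then show ?thesis
      using gauss_poly_0_right[of n] gauss_poly_0_right[of "Suc n"]
      by (simp add: gauss_row_fps_def distrib_right mult.assoc)
  next
    case (Suc i)
    have "gauss_row_fps q z (Suc n) $ Suc i =
        q ^ (i * (i - 1) div 2 + i) * z ^ Suc i *
          (q ^ Suc i * gauss_poly q (int n) (int (Suc i)) + gauss_poly q (int n) (int i))"
      by (simp only: gauss_row_fps_def fps_nth_Abs_fps triangular_pred_Suc gauss_poly_Suc_Suc)
    also have "\<dots> = q ^ Suc i * gauss_row_fps q z n $ Suc i + z * (q ^ i * gauss_row_fps q z n $ i)"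
      unfolding gauss_row_fps_def fps_nth_Abs_fps triangular_pred_Suc
      by (simp add: power_add algebra_simps del: of_nat_Suc)
    finally show ?thesis
      by (simp add: Suc distrib_right mult.assoc)
  qed
qed

end

section \<open>The generating function of \<open>e_sum\<close>\<close>

definition e_fps :: "complex \<Rightarrow> complex \<Rightarrow> complex \<Rightarrow> complex \<Rightarrow> nat \<Rightarrow> complex fps" where
  "e_fps x y z q n = fps_const (x ^ n * q ^ (n * (n + 1) div 2)) *
     (fps_dilate y (gauss_column_fps q n) *
       (gauss_row_fps q z n * (fps_X ^ n * gauss_column_fps q n)))"

definition e_sum_fps :: "complex \<Rightarrow> complex \<Rightarrow> complex \<Rightarrow> complex \<Rightarrow> complex fps" where
  "e_sum_fps x y z q = Abs_fps (\<lambda>m. e_sum (Suc m) x y z q)"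

lemma e_fps_nth:
  "e_fps x y z q n $ M = x ^ n * q ^ (n * (n + 1) div 2) *
     (\<Sum>j. gauss_poly q (int (n + j)) (int j) * y ^ j *
       (\<Sum>l. gauss_poly q (int M - int j - int l) (int n) *
          q ^ (l * (l - 1) div 2) * z ^ l * gauss_poly q (int n) (int l)))"
proof -
  define row_sum where
    "row_sum j = (\<Sum>l. gauss_row_fps q z n $ l * gauss_poly q (int M - int j - int l) (int n))" for j
  have "(gauss_row_fps q z n * (fps_X ^ n * gauss_column_fps q n)) $ (M - j) = row_sum j"
    if "j \<le> M" for j
    unfolding row_sum_def using that
    by (intro fps_mult_nth_suminf)
      (simp_all add: X_power_mult_gauss_column_fps_nth gauss_poly_eq_0 diff_diff_eq)
  moreover have "row_sum j = 0" if "M < j" for j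
    using that by (simp add: row_sum_def gauss_poly_eq_0)
  ultimately have product_nth: "(fps_dilate y (gauss_column_fps q n) *
      (gauss_row_fps q z n * (fps_X ^ n * gauss_column_fps q n))) $ M =
      (\<Sum>j. fps_dilate y (gauss_column_fps q n) $ j * row_sum j)"
    by (intro fps_mult_nth_suminf) simp_all
  show ?thesis
    unfolding e_fps_def fps_mult_left_const_nth product_nth
    by (simp add: row_sum_def gauss_column_fps_def gauss_row_fps_def mult_ac)
qed

lemma e_fps_nth_sums: "(\<lambda>n. e_fps x y z q n $ M) sums (e_sum_fps x y z q $ M)"
proof -
  have "e_fps x y z q n $ M = 0" if "n \<notin> {..M}" for n
    using that by (simp add: e_fps_nth gauss_poly_eq_0)
  then have "summable (\<lambda>n. e_fps x y z q n $ M)"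
    by (intro summable_finite[of "{..M}"]) simp_all
  moreover have "e_sum_fps x y z q $ M = (\<Sum>n. e_fps x y z q n $ M)"
    by (simp add: e_sum_fps_def e_sum_def e_fps_nth)
  ultimately show ?thesis
    by (simp only: summable_sums)
qed

lemma e_sum_0: "e_sum 0 x y z q = 0"
  by (simp add: e_sum_def gauss_poly_eq_0)

context non_root_of_unity
begin

lemma e_fps_0: "(1 - fps_X) * (1 - fps_const y * fps_X) * e_fps x y z q 0 = 1"
proof -
  have "(1 - fps_const y * fps_X) * fps_dilate y (gauss_column_fps q 0) = 1"
    using arg_cong[OF gauss_column_fps_0, of "fps_dilate y"]
    by (simp add: fps_dilate_mult fps_dilate_one_minus_X)
  moreover have "(1 - fps_X) * (1 - fps_const y * fps_X) * e_fps x y z q 0 =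
     ((1 - fps_const y * fps_X) * fps_dilate y (gauss_column_fps q 0)) *
       ((1 - fps_X) * gauss_column_fps q 0)"
    by (simp add: e_fps_def gauss_row_fps_0 mult_ac)
  ultimately show ?thesis
    by (simp add: gauss_column_fps_0)
qed

lemma e_fps_Suc:
  "(1 - fps_X) * (1 - fps_const y * fps_X) * e_fps x y z q (Suc n) =
    fps_const (x * q) * fps_X * (1 + fps_const z * fps_X) * fps_dilate q (e_fps x y z q n)"
proof -
  have dilated_column: "(1 - fps_const y * fps_X) * fps_dilate y (gauss_column_fps q (Suc n)) =
      fps_dilate q (fps_dilate y (gauss_column_fps q n))"
    using arg_cong[OF gauss_column_fps_Suc, of "fps_dilate y" n]
    by (simp add: fps_dilate_mult fps_dilate_one_minus_X fps_dilate_commute)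
  have "(1 - fps_X) * (1 - fps_const y * fps_X) * e_fps x y z q (Suc n) =
      fps_const (x ^ Suc n * q ^ (Suc n * (Suc n + 1) div 2)) *
        (((1 - fps_const y * fps_X) * fps_dilate y (gauss_column_fps q (Suc n))) *
          (gauss_row_fps q z (Suc n) * (fps_X ^ Suc n * ((1 - fps_X) * gauss_column_fps q (Suc n)))))"
    by (simp only: e_fps_def mult_ac)
  also have "\<dots> =
      fps_const (x * q) * fps_X * (1 + fps_const z * fps_X) * fps_dilate q (e_fps x y z q n)"
    unfolding dilated_column gauss_column_fps_Suc gauss_row_fps_Suc triangular_Suc
      e_fps_def fps_dilate_mult fps_dilate_const fps_dilate_X_power
    by (simp only: power_add power_Suc mult_ac flip: fps_const_mult)
  finally show ?thesis .
qed

lemma e_sum_fps_functional_equation: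
  "(1 - fps_X) * (1 - fps_const y * fps_X) * e_sum_fps x y z q =
    1 + fps_const (x * q) * fps_X * (1 + fps_const z * fps_X) * fps_dilate q (e_sum_fps x y z q)"
  (is "?D * _ = 1 + ?N * _")
proof (rule fps_ext)
  fix M
  have "(\<lambda>n. (?N * fps_dilate q (e_fps x y z q n)) $ M) sums
      ((?N * fps_dilate q (e_sum_fps x y z q)) $ M)"
    by (intro fps_mult_nth_sums) (simp add: sums_mult e_fps_nth_sums)
  then have "(\<lambda>n. (?D * e_fps x y z q (Suc n)) $ M) sums
      ((?N * fps_dilate q (e_sum_fps x y z q)) $ M)"
    by (simp only: e_fps_Suc)
  then have "(\<lambda>n. (?D * e_fps x y z q n) $ M) sums
      ((?N * fps_dilate q (e_sum_fps x y z q)) $ M + (?D * e_fps x y z q 0) $ M)"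
    by (rule sums_Suc)
  moreover have "(\<lambda>n. (?D * e_fps x y z q n) $ M) sums ((?D * e_sum_fps x y z q) $ M)"
    by (rule fps_mult_nth_sums) (rule e_fps_nth_sums)
  ultimately show "(?D * e_sum_fps x y z q) $ M = (1 + ?N * fps_dilate q (e_sum_fps x y z q)) $ M"
    by (simp only: e_fps_0 fps_add_nth add.commute sums_unique2)
qed

lemma e_sum_1: "e_sum (Suc 0) x y z q = 1"
  using arg_cong[OF e_sum_fps_functional_equation, of "\<lambda>f. f $ 0" y x z]
  by (simp add: e_sum_fps_def)

lemma e_sum_Suc_Suc:
  "e_sum (Suc (Suc m)) x y z q =
    (1 + y + x * q ^ Suc m) * e_sum (Suc m) x y z q - (y - x * z * q ^ m) * e_sum m x y z q"
proof -
  let ?E = "e_sum_fps x y z q"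
  have "((1 - fps_X) * (1 - fps_const y * fps_X) * ?E) $ Suc m =
      e_sum (Suc (Suc m)) x y z q - (1 + y) * e_sum (Suc m) x y z q + y * e_sum m x y z q"
    by (cases m) (simp_all add: e_sum_fps_def e_sum_0 left_diff_distrib mult.assoc,
      simp_all add: algebra_simps)
  moreover have "(fps_const (x * q) * fps_X * (1 + fps_const z * fps_X) * fps_dilate q ?E) $ Suc m =
      x * q ^ Suc m * e_sum (Suc m) x y z q + x * z * q ^ m * e_sum m x y z q"
    by (cases m) (simp_all add: e_sum_fps_def e_sum_0 distrib_right mult.assoc,
      simp_all add: algebra_simps)
  ultimately have "e_sum (Suc (Suc m)) x y z q - (1 + y) * e_sum (Suc m) x y z q + y * e_sum m x y z q =
      x * q ^ Suc m * e_sum (Suc m) x y z q + x * z * q ^ m * e_sum m x y z q"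
    by (simp add: e_sum_fps_functional_equation)
  then show ?thesis
    by (simp add: algebra_simps)
qed

end

section \<open>The \<open>q\<close>-difference equation of \<open>phi\<close>\<close>

definition phi_term :: "complex \<Rightarrow> complex \<Rightarrow> complex \<Rightarrow> complex \<Rightarrow> nat \<Rightarrow> complex" where
  "phi_term x y z q n =
     x ^ n * q ^ (n * (n + 1) div 2) * qpoch (- z) q n / (qpoch y q (n + 1) * qpoch q q n)"

lemma phi_term_mult: "phi_term (x * c) y z q n = c ^ n * phi_term x y z q n"
  by (simp add: phi_term_def power_mult_distrib)

lemma phi_term_Suc:
  "phi_term x y z q (Suc n) =
    x * q ^ Suc n * (1 + z * q ^ n) / ((1 - q ^ Suc n) * (1 - y * q ^ Suc n)) * phi_term x y z q n"
  unfolding phi_term_def triangular_Suc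
  by (simp add: power_add qpoch_Suc mult_ac)

lemma non_root_of_unity_if_norm_less_1: "norm q < 1 \<Longrightarrow> non_root_of_unity q"
  using power_eq_1_iff[of q] by unfold_locales auto

lemma phi_term_sums_phi:
  assumes "norm q < 1"
  shows "phi_term x y z q sums phi x y z q"
proof -
  have q_power: "(\<lambda>n. q ^ n) \<longlonglongrightarrow> 0"
    using assms by (rule LIMSEQ_power_zero)
  define r where "r n = x * q ^ Suc n * (1 + z * q ^ n) / ((1 - q ^ Suc n) * (1 - y * q ^ Suc n))" for n
  have "r \<longlonglongrightarrow> x * 0 * (1 + z * 0) / ((1 - 0) * (1 - y * 0))"
    unfolding r_def by (intro tendsto_intros q_power LIMSEQ_Suc[OF q_power]) simp
  moreover have "phi_term x y z q (Suc n) = r n * phi_term x y z q n" for n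
    unfolding r_def by (rule phi_term_Suc)
  ultimately have "summable (phi_term x y z q)"
    by (intro summable_ratio_tendsto[of _ r 0]) simp_all
  then show ?thesis
    using summable_sums by (simp only: phi_def flip: phi_term_def)
qed

lemma phi_q_difference:
  assumes "norm q < 1" and y: "\<And>n. y * q ^ n \<noteq> 1"
  shows "(y - x * z * q) * phi (x * q ^ 2) y z q =
    (1 + y + x * q) * phi (x * q) y z q - phi x y z q"
proof -
  interpret non_root_of_unity q
    using assms(1) by (rule non_root_of_unity_if_norm_less_1)
  define t where "t = phi_term x y z q"
  define p where "p k = phi (x * q ^ k) y z q" for k
  define g where "g n = (1 - q ^ n) * (1 - y * q ^ n) * t n" for n
  have dilated_sums: "(\<lambda>n. (q ^ k) ^ n * t n) sums p k" for k
    using phi_term_sums_phi[OF assms(1), of "x * q ^ k" y z]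
    by (simp add: p_def t_def flip: phi_term_mult)
  have g_Suc: "g (Suc n) = x * q ^ Suc n * (1 + z * q ^ n) * t n" for n
    using power_neq_1[of "Suc n"] y[of "Suc n"]
    by (simp add: g_def t_def phi_term_Suc del: power_Suc)
  have "(\<lambda>n. (q ^ 0) ^ n * t n - (1 + y) * ((q ^ 1) ^ n * t n) + y * ((q ^ 2) ^ n * t n))
      sums (p 0 - (1 + y) * p 1 + y * p 2)"
    by (intro sums_add sums_diff sums_mult dilated_sums)
  also have "(\<lambda>n. (q ^ 0) ^ n * t n - (1 + y) * ((q ^ 1) ^ n * t n) + y * ((q ^ 2) ^ n * t n)) = g"
    by (rule ext) (simp add: g_def algebra_simps power2_eq_square)
  finally have "g sums (p 0 - (1 + y) * p 1 + y * p 2)" .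
  then have "(\<lambda>n. g (Suc n)) sums (p 0 - (1 + y) * p 1 + y * p 2)"
    by (subst sums_Suc_iff) (simp add: g_def)
  moreover have "(\<lambda>n. x * q * ((q ^ 1) ^ n * t n) + x * q * z * ((q ^ 2) ^ n * t n))
      sums (x * q * p 1 + x * q * z * p 2)"
    by (intro sums_add sums_mult dilated_sums)
  then have "(\<lambda>n. g (Suc n)) sums (x * q * p 1 + x * q * z * p 2)"
    by (simp add: g_Suc algebra_simps power2_eq_square)
  ultimately have "p 0 - (1 + y) * p 1 + y * p 2 = x * q * p 1 + x * q * z * p 2"
    by (rule sums_unique2)
  then show ?thesis
    by (simp add: p_def algebra_simps)
qed

lemma prod_mult_phi_dilated:
  assumes "norm q < 1" and "\<And>n. y * q ^ n \<noteq> 1"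
  shows "(\<Prod>j=1..m. y - x * z * q ^ j) * phi (x * q ^ Suc m) y z q =
    e_sum (Suc m) x y z q * phi (x * q) y z q - e_sum m (x * q) y z q * phi x y z q"
proof -
  interpret non_root_of_unity q
    using assms(1) by (rule non_root_of_unity_if_norm_less_1)
  have "(\<Prod>j=1..m. y - x * z * q ^ j) * phi (x * q ^ Suc m) y z q =
      e_sum (Suc m) x y z q * phi (x * q ^ Suc 0) y z q - e_sum m (x * q) y z q * phi (x * q ^ 0) y z q"
  proof (rule prod_mult_three_term_recurrence[where b = "\<lambda>k. 1 + y + x * q ^ k"])
    show "(y - x * z * q ^ Suc k) * phi (x * q ^ Suc (Suc k)) y z q =
        (1 + y + x * q ^ Suc k) * phi (x * q ^ Suc k) y z q - phi (x * q ^ k) y z q" for k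
      using phi_q_difference[OF assms, of "x * q ^ k" z] by (simp add: power2_eq_square mult_ac)
    show "e_sum (Suc (Suc k)) (x * q) y z q = (1 + y + x * q ^ Suc (Suc k)) * e_sum (Suc k) (x * q) y z q -
        (y - x * z * q ^ Suc k) * e_sum k (x * q) y z q" for k
      using e_sum_Suc_Suc[of k "x * q" y z] by (simp add: mult_ac)
  qed (rule e_sum_Suc_Suc e_sum_0 e_sum_1)+
  then show ?thesis by simp
qed

theorem theorem2p3:
  fixes x y z q :: complex and m :: nat
  assumes "norm q < 1"
    and "\<And>n::nat. y \<noteq> q powi (- int n)"
    and "\<And>n::nat. y \<noteq> x * z * q ^ n"
    and "m \<ge> 2"
  shows "phi (x * q ^ m) y z q =
    (e_sum m x y z q * phi (x * q) y z q - e_sum (m - 1) (x * q) y z q * phi x y z q)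
      / (\<Prod>j=1..m - 1. y - x * z * q ^ j)"
proof -
  have "y * q ^ n \<noteq> 1" for n
    using assms(2)[of n] inverse_unique[of "q ^ n" y] by (auto simp: power_int_minus mult.commute)
  then have "(\<Prod>j=1..m - 1. y - x * z * q ^ j) * phi (x * q ^ m) y z q =
      e_sum m x y z q * phi (x * q) y z q - e_sum (m - 1) (x * q) y z q * phi x y z q"
    using prod_mult_phi_dilated[OF assms(1), where m = "m - 1"] assms(4) by simp
  moreover have "(\<Prod>j=1..m - 1. y - x * z * q ^ j) \<noteq> 0"
    using assms(3) by simp
  ultimately show ?thesis
    by (simp add: nonzero_eq_divide_eq mult.commute)
qed

end
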